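(* Let $(X,d)$ be a metric circle, i.e. a metric space homeomorphic to the circle $S^1$. Then $X$ admits a local Lipschitz mixer if and only if $X$ has bounded turning.
   Context: For a metric space $(X,d)$, the power $X^3$ and its subsets carry the metric $d(a,b)=\sum_{k=1}^3 d(a_k,b_k)$. A map is Lipschitz if it multiplies distances by at most some constant factor $L$. For $r>0$ let $\Delta_r(X^3)=\{(x_1,x_2,x_3)\in X^3\colon \max_{i<j}d(x_i,x_j)\le r\}$. The space $X$ admits a local Lipschitz mixer if there exist $r>0$ and a Lipschitz map $\sigma\colon\Delta_r(X^3)\to X$ with the absorption property $\sigma(a,a,b)=\sigma(a,b,a)=\sigma(b,a,a)=a$ for all $a,b\in X$ for which these triples belong to $\Delta_r(X^3)$. A metric space $X$ has bounded turning if there exists a constant $C$ such that any two points $a,b\in X$ are contained in some compact connected set $E\subset X$ with $\operatorname{diam}E\le C\,d(a,b)$. *)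

theory Defs
  imports "HOL-Analysis.Analysis"
begin

text \<open>A metric space is a subset \<open>X\<close> of a type of class \<^class>\<open>metric_space\<close>, with the metric
  \<^const>\<open>dist\<close> restricted to \<open>X\<close>.\<close>

text \<open>The library's \<^const>\<open>dist\<close> on products is the Euclidean one, hence a separate definition of the
  sum metric.\<close>

definition dist3 :: "'a::metric_space \<times> 'a \<times> 'a \<Rightarrow> 'a \<times> 'a \<times> 'a \<Rightarrow> real" where
  "dist3 = (\<lambda>(a1, a2, a3) (b1, b2, b3). dist a1 b1 + dist a2 b2 + dist a3 b3)"

definition Delta3 :: "real \<Rightarrow> 'a::metric_space set \<Rightarrow> ('a \<times> 'a \<times> 'a) set" where
  "Delta3 r X = {(x1, x2, x3). x1 \<in> X \<and> x2 \<in> X \<and> x3 \<in> X \<and>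
     Max {dist x1 x2, dist x1 x3, dist x2 x3} \<le> r}"

definition lipschitz3 :: "('a::metric_space \<times> 'a \<times> 'a) set \<Rightarrow> ('a \<times> 'a \<times> 'a \<Rightarrow> 'a) \<Rightarrow> bool" where
  "lipschitz3 D f \<longleftrightarrow> (\<exists>L\<ge>0. \<forall>p\<in>D. \<forall>q\<in>D. dist (f p) (f q) \<le> L * dist3 p q)"

definition admits_local_lipschitz_mixer :: "'a::metric_space set \<Rightarrow> bool" where
  "admits_local_lipschitz_mixer X \<longleftrightarrow>
     (\<exists>r>0. \<exists>\<sigma>. \<sigma> \<in> Delta3 r X \<rightarrow> X \<and> lipschitz3 (Delta3 r X) \<sigma> \<and>
        (\<forall>a\<in>X. \<forall>b\<in>X. {(a, a, b), (a, b, a), (b, a, a)} \<subseteq> Delta3 r X \<longrightarrow>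
           \<sigma> (a, a, b) = a \<and> \<sigma> (a, b, a) = a \<and> \<sigma> (b, a, a) = a))"

definition bounded_turning :: "'a::metric_space set \<Rightarrow> bool" where
  "bounded_turning X \<longleftrightarrow>
     (\<exists>C. \<forall>a\<in>X. \<forall>b\<in>X. \<exists>E\<subseteq>X. compact E \<and> connected E \<and> a \<in> E \<and> b \<in> E \<and>
        diameter E \<le> C * dist a b)"

definition metric_circle :: "'a::metric_space set \<Rightarrow> bool" where
  "metric_circle X \<longleftrightarrow> X homeomorphic sphere (0::complex) 1"

end

theory Submission
  imports Defs
begin

text \<open>Parametrize the circle by a covering \<open>g : \<real> \<rightarrow> X\<close> of period \<open>2\<pi>\<close>.

  Suppose that \<open>\<sigma>\<close> is a local mixer. Nearby points \<open>a\<close>, \<open>b\<close> are joined by a small arc \<open>E\<close>, and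
  \<open>\<sigma>(a, b, \<cdot>)\<close> maps \<open>E\<close> to a continuum that contains \<open>\<sigma>(a, b, a) = a\<close> and \<open>\<sigma>(a, b, b) = b\<close> and lies
  within \<open>L d(a, b)\<close> of \<open>a\<close>, because \<open>\<sigma>(a, a, x) = a\<close>.

  Conversely, the points of a triple in \<open>\<Delta>\<^sub>r\<close> have nearby lifts, and \<open>\<sigma>\<close> is the image under \<open>g\<close> of the
  median of these lifts. If one lift moves from \<open>s\<close> to \<open>t\<close>, the median either stays or moves inside
  the segment between \<open>s\<close> and \<open>t\<close>. Every continuum of small diameter that joins \<open>g s\<close> and \<open>g t\<close>
  contains the image of this segment, so bounded turning gives the Lipschitz estimate.\<close>

section \<open>Diameters, triples, and the map \<open>cis\<close>\<close>

lemma diameter_le_metric: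
  fixes S :: "'a::metric_space set"
  assumes "S \<noteq> {}" and "\<And>x y. x \<in> S \<Longrightarrow> y \<in> S \<Longrightarrow> dist x y \<le> d"
  shows "diameter S \<le> d"
  using assms by (auto simp: diameter_def intro!: cSUP_least)

lemma Delta3_iff:
  "(x, y, z) \<in> Delta3 r X \<longleftrightarrow>
     x \<in> X \<and> y \<in> X \<and> z \<in> X \<and> dist x y \<le> r \<and> dist x z \<le> r \<and> dist y z \<le> r"
  by (simp add: Delta3_def)

lemma cis_eq_cis_iff: "cis s = cis t \<longleftrightarrow> (\<exists>n::int. s = t + 2 * pi * n)"
  using sin_cos_eq_iff[of s t] by (auto simp: complex_eq_iff)

lemma dist_cis_le: "dist (cis s) (cis t) \<le> \<bar>s - t\<bar>"
proof -
  have "cis s - cis t = cis t * (cis (s - t) - 1)"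
    by (simp add: right_diff_distrib cis_mult)
  then have "dist (cis s) (cis t) = norm (exp (\<i> * of_real (s - t)) - 1)"
    by (simp add: dist_norm norm_mult cis_conv_exp)
  also have "\<dots> = 2 * \<bar>sin ((s - t) / 2)\<bar>"
    by (rule dist_exp_i_1)
  also have "\<dots> \<le> \<bar>s - t\<bar>"
    using abs_sin_x_le_abs_x[of "(s - t) / 2"] by simp
  finally show ?thesis .
qed

text \<open>The constant 6 is a convenient lower bound for the period, as \<open>2 * pi > 6\<close>
  follows from \<open>pi_gt3\<close>.\<close>

lemma int_eq_0_if_small:
  fixes n :: int
  assumes "\<bar>2 * pi * n\<bar> < 6"
  shows "n = 0"
proof (rule ccontr)
  assume "n \<noteq> 0"
  then have "1 \<le> \<bar>real_of_int n\<bar>" by linarith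
  then have "2 * pi * 1 \<le> 2 * pi * \<bar>real_of_int n\<bar>" by (intro mult_left_mono) auto
  moreover have "2 * pi * \<bar>real_of_int n\<bar> < 6" using assms by (simp add: abs_mult)
  ultimately show False using pi_gt3 by linarith
qed

section \<open>The median on the real line\<close>

definition median :: "real \<Rightarrow> real \<Rightarrow> real \<Rightarrow> real" where
  "median a b c = max (min a b) (min (max a b) c)"

lemma median_absorb [simp]: "median a a b = a" "median a b a = a" "median b a a = a"
  by (auto simp: median_def)

lemma median_add: "median (a + x) (b + x) (c + x) = median a b c + x"
  by (auto simp: median_def min_def max_def)

lemma median_commute: "median a b c = median b a c" "median a b c = median a c b"
  by (auto simp: median_def min_def max_def)

text \<open>As a function of its first argument, the median clamps to the interval between
  \<open>p\<close> and \<open>q\<close>. Let \<open>s < t\<close>. If clamping lowers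
  \<open>s\<close> or raises \<open>t\<close>, then both lie on the same side of the interval and
  the two values agree. Otherwise monotonicity puts both values between \<open>s\<close> and
  \<open>t\<close>.\<close>

lemma median_moves_in_segment:
  "median s p q = median t p q \<or>
     median s p q \<in> closed_segment s t \<and> median t p q \<in> closed_segment s t"
  by (auto simp: median_def min_def max_def closed_segment_eq_real_ivl)

section \<open>Coverings of a metric circle by the line\<close>

locale circle_covering =
  fixes X :: "'a::metric_space set" and g :: "real \<Rightarrow> 'a"
  assumes compact_X: "compact X"
    and range_g: "range g = X"
    and g_eq_iff: "g s = g t \<longleftrightarrow> (\<exists>n::int. s = t + 2 * pi * n)"
    and uniform_g: "uniformly_continuous_on UNIV g"
    and local_lift: "\<epsilon> > 0 \<Longrightarrow> \<exists>\<delta>>0. \<forall>t. \<exists>w. continuous_on (X \<inter> ball (g t) \<delta>) w \<and>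
      (\<forall>z\<in>X \<inter> ball (g t) \<delta>. g (t + w z) = z \<and> \<bar>w z\<bar> < \<epsilon>)"

text \<open>The covering is \<open>cis\<close> followed by a homeomorphism from the unit circle. Its
  local inverse near \<open>g t\<close> is the principal argument of \<open>f z / cis t\<close>:
  this quotient is 1 at \<open>z = g t\<close>, and \<open>Arg\<close> is continuous there.\<close>

lemma metric_circle_covering:
  fixes X :: "'a::metric_space set"
  assumes "metric_circle X"
  obtains g where "circle_covering X g"
proof -
  obtain f h where fh: "homeomorphism X (sphere (0::complex) 1) f h"
    using assms by (auto simp: metric_circle_def homeomorphic_def)
  define g where "g = h \<circ> cis"
  have cis_in: "cis t \<in> sphere 0 1" for t by simp
  have hf: "h (f x) = x" "f x \<in> sphere 0 1" if "x \<in> X" for x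
    using fh that by (auto simp: homeomorphism_def)
  have f_g: "f (g t) = cis t" and g_X: "g t \<in> X" for t
    using fh cis_in[of t] by (auto simp: homeomorphism_def g_def)
  have contf: "continuous_on X f" and conth: "continuous_on (sphere 0 1) h"
    using fh by (auto simp: homeomorphism_def)
  have compX: "compact X"
    using fh compact_continuous_image[OF conth] by (auto simp: homeomorphism_def)
  have g_Arg: "g (t + Arg (f z / cis t)) = z" if "z \<in> X" for t z
  proof -
    have "cis (Arg (f z / cis t)) = f z / cis t"
      using hf(2)[OF that] by (subst cis_Arg) (auto simp: sgn_eq norm_divide)
    then have "cis (t + Arg (f z / cis t)) = f z"
      by (simp flip: cis_mult)
    then show ?thesis by (simp add: g_def hf that)
  qed
  have "circle_covering X g"
  proof
    show "compact X" by (fact compX)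
    show "range g = X"
      using g_X g_Arg by (metis (no_types) UNIV_I image_subset_iff subsetI image_eqI subset_antisym)
    show "g s = g t \<longleftrightarrow> (\<exists>n::int. s = t + 2 * pi * n)" for s t
      using f_g by (metis cis_eq_cis_iff comp_apply g_def)
    have "uniformly_continuous_on UNIV cis"
      unfolding uniformly_continuous_on_def
      by (metis dist_cis_le dist_real_def order_le_less_trans)
    moreover have "uniformly_continuous_on (range cis) h"
      using compact_uniformly_continuous[OF conth compact_sphere] cis_in
      unfolding uniformly_continuous_on_def by (metis (no_types, lifting) rangeE)
    ultimately show "uniformly_continuous_on UNIV g"
      unfolding g_def o_def by (rule uniformly_continuous_on_compose)
  next
    fix \<epsilon> :: real assume "\<epsilon> > 0"
    have "isCont Arg 1" by (rule continuous_at_Arg) (simp add: complex_nonpos_Reals_iff)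
    then obtain \<eta> where \<eta>: "\<eta> > 0" "\<And>u. dist u 1 < \<eta> \<Longrightarrow> dist (Arg u) (Arg 1) < \<epsilon>"
      unfolding continuous_at_eps_delta using \<open>\<epsilon> > 0\<close> by blast
    \<comment> \<open>Uniform continuity of \<open>f\<close> gives a radius that works for every
      \<open>t\<close>. The bound \<eta> makes the argument small, and the bound 1 keeps the
      quotient off the branch cut of \<open>Arg\<close>.\<close>
    obtain \<delta> where \<delta>: "\<delta> > 0"
      "\<And>x y. x \<in> X \<Longrightarrow> y \<in> X \<Longrightarrow> dist y x < \<delta> \<Longrightarrow> dist (f y) (f x) < min \<eta> 1"
      using compact_uniformly_continuous[OF contf compX] \<eta>(1)
      unfolding uniformly_continuous_on_def by (metis min_less_iff_conj zero_less_one)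
    show "\<exists>\<delta>>0. \<forall>t. \<exists>w. continuous_on (X \<inter> ball (g t) \<delta>) w \<and>
      (\<forall>z\<in>X \<inter> ball (g t) \<delta>. g (t + w z) = z \<and> \<bar>w z\<bar> < \<epsilon>)"
    proof (intro exI[of _ \<delta>] conjI allI \<delta>(1))
      fix t
      have close: "dist (f z / cis t) 1 < min \<eta> 1" if "z \<in> X \<inter> ball (g t) \<delta>" for z
      proof -
        have "f z / cis t - 1 = (f z - cis t) / cis t" by (simp add: diff_divide_distrib)
        then have "dist (f z / cis t) 1 = dist (f z) (f (g t))"
          by (simp add: dist_norm norm_divide f_g)
        then show ?thesis using \<delta>(2)[OF g_X, of z t] that by (simp add: dist_commute)
      qed
      show "\<exists>w. continuous_on (X \<inter> ball (g t) \<delta>) w \<and>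
        (\<forall>z\<in>X \<inter> ball (g t) \<delta>. g (t + w z) = z \<and> \<bar>w z\<bar> < \<epsilon>)"
      proof (intro exI[of _ "\<lambda>z. Arg (f z / cis t)"] conjI ballI)
        have "f z / cis t \<notin> \<real>\<^sub>\<le>\<^sub>0" if "z \<in> X \<inter> ball (g t) \<delta>" for z
        proof
          assume "f z / cis t \<in> \<real>\<^sub>\<le>\<^sub>0"
          then have "1 \<le> \<bar>Re (f z / cis t - 1)\<bar>" by (simp add: complex_nonpos_Reals_iff)
          also have "\<dots> \<le> dist (f z / cis t) 1" unfolding dist_norm by (rule abs_Re_le_cmod)
          finally show False using close[OF that] by simp
        qed
        then show "continuous_on (X \<inter> ball (g t) \<delta>) (\<lambda>z. Arg (f z / cis t))"
          by (intro continuous_intros continuous_on_subset[OF contf]) auto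
      next
        fix z assume z: "z \<in> X \<inter> ball (g t) \<delta>"
        then show "g (t + Arg (f z / cis t)) = z" by (simp add: g_Arg)
        show "\<bar>Arg (f z / cis t)\<bar> < \<epsilon>"
          using \<eta>(2)[of "f z / cis t"] close[OF z] by (simp add: dist_real_def)
      qed
    qed
  qed
  then show ?thesis by (rule that)
qed

context circle_covering
begin

lemma g_in_X [simp]: "g t \<in> X"
  using range_g by blast

lemma dist_le_diameter: "x \<in> X \<Longrightarrow> y \<in> X \<Longrightarrow> dist x y \<le> diameter X"
  by (simp add: compact_X compact_imp_bounded diameter_bounded_bound)

lemma diameter_nonneg: "0 \<le> diameter X"
  by (simp add: compact_X compact_imp_bounded diameter_ge_0)

lemma continuous_g: "continuous_on S g"
  using uniform_g continuous_on_subset uniformly_continuous_imp_continuous by blast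

lemma g_eq_imp_eq: "g s = g t \<Longrightarrow> \<bar>s - t\<bar> < 6 \<Longrightarrow> s = t"
  by (auto simp: g_eq_iff dest: int_eq_0_if_small)

lemma lift_near:
  assumes "\<epsilon> > 0"
  obtains \<delta> where "\<delta> > 0"
    "\<And>t y. y \<in> X \<Longrightarrow> dist (g t) y < \<delta> \<Longrightarrow> \<exists>s. y = g s \<and> \<bar>s - t\<bar> < \<epsilon>"
proof -
  obtain \<delta> where \<delta>: "\<delta> > 0" "\<And>t. \<exists>w. continuous_on (X \<inter> ball (g t) \<delta>) w \<and>
      (\<forall>z\<in>X \<inter> ball (g t) \<delta>. g (t + w z) = z \<and> \<bar>w z\<bar> < \<epsilon>)"
    using local_lift[OF assms] by blast
  show ?thesis
  proof (rule that[OF \<delta>(1)])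
    fix t y assume "y \<in> X" "dist (g t) y < \<delta>"
    then obtain w where "g (t + w) = y" "\<bar>w\<bar> < \<epsilon>" using \<delta>(2)[of t] by force
    then show "\<exists>s. y = g s \<and> \<bar>s - t\<bar> < \<epsilon>" by (intro exI[of _ "t + w"]) auto
  qed
qed

section \<open>From a mixer to bounded turning\<close>

text \<open>The image under \<open>g\<close> of the segment between two nearby lifts is such an arc.
  Its diameter need not be comparable to \<open>dist a b\<close>; the bound \<open>r\<close> only
  serves to keep the triples \<open>(a, b, x)\<close> with \<open>x\<close> on the arc in the domain
  of the mixer.\<close>

lemma small_connecting_arc:
  assumes "r > 0"
  obtains \<delta> where "\<delta> > 0" "\<And>a b. a \<in> X \<Longrightarrow> b \<in> X \<Longrightarrow> dist a b < \<delta> \<Longrightarrow>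
    \<exists>E\<subseteq>X. compact E \<and> connected E \<and> a \<in> E \<and> b \<in> E \<and> (\<forall>x\<in>E. \<forall>y\<in>E. dist x y \<le> r)"
proof -
  obtain \<epsilon> where \<epsilon>: "\<epsilon> > 0" "\<And>s t. dist s t < \<epsilon> \<Longrightarrow> dist (g s) (g t) < r"
    using uniform_g assms unfolding uniformly_continuous_on_def by blast
  obtain \<delta> where \<delta>: "\<delta> > 0"
    "\<And>t y. y \<in> X \<Longrightarrow> dist (g t) y < \<delta> \<Longrightarrow> \<exists>s. y = g s \<and> \<bar>s - t\<bar> < \<epsilon>"
    using lift_near[OF \<epsilon>(1)] by blast
  show ?thesis
  proof (rule that[OF \<delta>(1)])
    fix a b assume "a \<in> X" "b \<in> X" "dist a b < \<delta>"
    then obtain t s where ts: "a = g t" "b = g s" "\<bar>s - t\<bar> < \<epsilon>"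
      using \<delta>(2) range_g by (metis rangeE)
    have "dist (g x) (g y) \<le> r" if "x \<in> closed_segment t s" "y \<in> closed_segment t s" for x y
    proof -
      have "dist x y < \<epsilon>"
        using that ts(3) by (auto simp: closed_segment_eq_real_ivl dist_real_def split: if_splits)
      then show ?thesis using \<epsilon>(2) by (simp add: less_imp_le)
    qed
    then show "\<exists>E\<subseteq>X. compact E \<and> connected E \<and> a \<in> E \<and> b \<in> E \<and> (\<forall>x\<in>E. \<forall>y\<in>E. dist x y \<le> r)"
      using ts
      by (intro exI[of _ "g ` closed_segment t s"] conjI compact_continuous_image
          connected_continuous_image continuous_g) auto
  qed
qed

lemma mixer_imp_bounded_turning:
  assumes "admits_local_lipschitz_mixer X"
  shows "bounded_turning X"
proof -
  obtain r \<sigma> where r: "r > 0" and \<sigma>: "\<sigma> \<in> Delta3 r X \<rightarrow> X" "lipschitz3 (Delta3 r X) \<sigma>"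
    and absorb: "\<And>a b. a \<in> X \<Longrightarrow> b \<in> X \<Longrightarrow> {(a, a, b), (a, b, a), (b, a, a)} \<subseteq> Delta3 r X \<Longrightarrow>
        \<sigma> (a, a, b) = a \<and> \<sigma> (a, b, a) = a \<and> \<sigma> (b, a, a) = a"
    using assms unfolding admits_local_lipschitz_mixer_def by blast
  obtain L where L: "L \<ge> 0"
    "\<And>p q. p \<in> Delta3 r X \<Longrightarrow> q \<in> Delta3 r X \<Longrightarrow> dist (\<sigma> p) (\<sigma> q) \<le> L * dist3 p q"
    using \<sigma>(2) unfolding lipschitz3_def by blast
  have absorb': "\<sigma> (a, a, b) = a" "\<sigma> (a, b, a) = a" "\<sigma> (b, a, a) = a"
    if "a \<in> X" "b \<in> X" "dist a b \<le> r" for a b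
    using absorb[of a b] that r by (auto simp: Delta3_iff dist_commute)
  obtain \<delta> where \<delta>: "\<delta> > 0" "\<And>a b. a \<in> X \<Longrightarrow> b \<in> X \<Longrightarrow> dist a b < \<delta> \<Longrightarrow>
    \<exists>E\<subseteq>X. compact E \<and> connected E \<and> a \<in> E \<and> b \<in> E \<and> (\<forall>x\<in>E. \<forall>y\<in>E. dist x y \<le> r)"
    using small_connecting_arc[OF r] by blast
  \<comment> \<open>The term \<open>2 * L\<close> bounds the diameter of a set within
    \<open>L * dist a b\<close> of \<open>a\<close>. The other term covers pairs at distance at
    least \<delta>, for which all of \<open>X\<close> serves as the continuum.\<close>
  define C where "C = 2 * L + diameter X / \<delta>"
  have D: "diameter X / \<delta> \<ge> 0" using diameter_nonneg \<delta>(1) by simp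
  show ?thesis
    unfolding bounded_turning_def
  proof (intro exI[of _ C] ballI)
    fix a b assume ab: "a \<in> X" "b \<in> X"
    show "\<exists>E\<subseteq>X. compact E \<and> connected E \<and> a \<in> E \<and> b \<in> E \<and> diameter E \<le> C * dist a b"
    proof (cases "dist a b < \<delta>")
      case True
      then obtain E where E: "E \<subseteq> X" "compact E" "connected E" "a \<in> E" "b \<in> E"
        "\<And>x y. x \<in> E \<Longrightarrow> y \<in> E \<Longrightarrow> dist x y \<le> r"
        using \<delta>(2)[OF ab] by blast
      define F where "F = (\<lambda>x. \<sigma> (a, b, x)) ` E"
      have in_Delta: "(a, b, x) \<in> Delta3 r X" "(a, a, x) \<in> Delta3 r X" if "x \<in> E" for x
        using E that ab r by (auto simp: Delta3_iff)
      have "L-lipschitz_on E (\<lambda>x. \<sigma> (a, b, x))"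
      proof (rule lipschitz_onI)
        fix x y assume "x \<in> E" "y \<in> E"
        then show "dist (\<sigma> (a, b, x)) (\<sigma> (a, b, y)) \<le> L * dist x y"
          using L(2)[OF in_Delta(1) in_Delta(1), of x y] by (simp add: dist3_def)
      qed (fact L(1))
      then have cont: "continuous_on E (\<lambda>x. \<sigma> (a, b, x))"
        by (rule lipschitz_on_continuous_on)
      \<comment> \<open>Replacing \<open>b\<close> by \<open>a\<close> in the second coordinate
        moves the triple by exactly \<open>dist a b\<close> and turns the value into
        \<open>a\<close>.\<close>
      have near: "dist z a \<le> L * dist a b" if z: "z \<in> F" for z
      proof -
        obtain x where x: "x \<in> E" "z = \<sigma> (a, b, x)" using z by (auto simp: F_def)
        then have "\<sigma> (a, a, x) = a" using absorb' E ab by (metis subsetD)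
        then show ?thesis
          using L(2)[OF in_Delta[OF x(1)]] x(2) by (simp add: dist3_def dist_commute)
      qed
      have "dist x y \<le> C * dist a b" if "x \<in> F" "y \<in> F" for x y
      proof -
        have "dist x y \<le> dist x a + dist y a" by (rule dist_triangle2)
        also have "\<dots> \<le> 2 * L * dist a b" using near[OF that(1)] near[OF that(2)] by simp
        also have "\<dots> \<le> C * dist a b" using D by (intro mult_right_mono) (auto simp: C_def)
        finally show ?thesis .
      qed
      then have "diameter F \<le> C * dist a b"
        using E(4) by (intro diameter_le_metric) (auto simp: F_def)
      moreover have "a \<in> F" "b \<in> F"
        using absorb'(2)[OF ab] absorb'(3)[OF ab(2) ab(1)] E(4-6)
        by (force simp: F_def dist_commute)+
      moreover have "F \<subseteq> X" using \<sigma>(1) in_Delta by (auto simp: F_def)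
      moreover have "compact F" "connected F"
        unfolding F_def using cont E by (auto intro: compact_continuous_image connected_continuous_image)
      ultimately show ?thesis by blast
    next
      case False
      have "diameter X = diameter X / \<delta> * \<delta>" using \<delta>(1) by simp
      also have "\<dots> \<le> diameter X / \<delta> * dist a b" using D False by (intro mult_left_mono) auto
      also have "\<dots> \<le> C * dist a b" using L(1) by (intro mult_right_mono) (auto simp: C_def)
      finally have "diameter X \<le> C * dist a b" .
      moreover have "connected X"
        using connected_continuous_image[OF continuous_g connected_UNIV] range_g by simp
      ultimately show ?thesis using ab compact_X by blast
    qed
  qed
qed

section \<open>From bounded turning to a mixer\<close>

text \<open>If \<open>g s\<close> and \<open>g t\<close> are close, the continuum joining them fits
  into a ball on which \<open>g\<close> has a continuous local inverse. Its lift is connected and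
  contains both endpoints, hence the whole segment. Distant endpoints are handled by the diameter of
  \<open>X\<close>.\<close>

lemma segment_estimate:
  assumes "bounded_turning X"
  obtains K where "K \<ge> 0"
    "\<And>s t a b. \<bar>s - t\<bar> \<le> 1 \<Longrightarrow> a \<in> closed_segment s t \<Longrightarrow> b \<in> closed_segment s t \<Longrightarrow>
      dist (g a) (g b) \<le> K * dist (g s) (g t)"
proof -
  obtain C where C: "\<And>a b. a \<in> X \<Longrightarrow> b \<in> X \<Longrightarrow> \<exists>E\<subseteq>X. compact E \<and> connected E \<and> a \<in> E \<and> b \<in> E \<and>
        diameter E \<le> C * dist a b"
    using assms unfolding bounded_turning_def by blast
  obtain \<delta> where \<delta>: "\<delta> > 0" "\<And>t. \<exists>w. continuous_on (X \<inter> ball (g t) \<delta>) w \<and>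
      (\<forall>z\<in>X \<inter> ball (g t) \<delta>. g (t + w z) = z \<and> \<bar>w z\<bar> < 1)"
    using local_lift[of 1] by auto
  \<comment> \<open>Taking the maximum with 1 makes the constant positive, whatever the sign of
    \<open>C\<close>.\<close>
  define B where "B = max C 1"
  define K where "K = B + diameter X * B / \<delta>"
  have B: "B \<ge> 1" "C \<le> B" by (auto simp: B_def)
  have D: "diameter X * B / \<delta> \<ge> 0" using diameter_nonneg \<delta>(1) B by simp
  show ?thesis
  proof (rule that)
    show "K \<ge> 0" using B D by (simp add: K_def)
    fix s t a b :: real
    assume st: "\<bar>s - t\<bar> \<le> 1" and ab: "a \<in> closed_segment s t" "b \<in> closed_segment s t"
    show "dist (g a) (g b) \<le> K * dist (g s) (g t)"
    proof (cases "B * dist (g s) (g t) < \<delta>")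
      case True
      obtain E where E: "E \<subseteq> X" "compact E" "connected E" "g s \<in> E" "g t \<in> E"
        "diameter E \<le> C * dist (g s) (g t)"
        using C[of "g s" "g t"] by auto
      have "C * dist (g s) (g t) \<le> B * dist (g s) (g t)"
        using B by (intro mult_right_mono) auto
      then have dist_E: "dist x y \<le> B * dist (g s) (g t)" if "x \<in> E" "y \<in> E" for x y
        using diameter_bounded_bound[OF compact_imp_bounded[OF E(2)] that] E(6) by linarith
      then have "E \<subseteq> X \<inter> ball (g s) \<delta>" using True E by fastforce
      moreover obtain w where w: "continuous_on (X \<inter> ball (g s) \<delta>) w"
        "\<And>z. z \<in> X \<inter> ball (g s) \<delta> \<Longrightarrow> g (s + w z) = z \<and> \<bar>w z\<bar> < 1"
        using \<delta>(2)[of s] by blast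
      ultimately have cont: "continuous_on E w" and gw: "\<And>z. z \<in> E \<Longrightarrow> g (s + w z) = z"
        and small: "\<And>z. z \<in> E \<Longrightarrow> \<bar>w z\<bar> < 1"
        by (blast intro: continuous_on_subset)+
      have "w (g s) = 0"
        \<comment> \<open>The lift of \<open>g s\<close> is within 1 of \<open>s\<close>, too close
          to differ from it by a nonzero period. In the same way the lift of \<open>g t\<close> is
          within 2 of \<open>t\<close>, since \<open>\<bar>s - t\<bar> \<le> 1\<close>.\<close>
        using g_eq_imp_eq[OF gw[OF E(4)]] small[OF E(4)] by auto
      moreover have "w (g t) = t - s"
        using g_eq_imp_eq[OF gw[OF E(5)]] small[OF E(5)] st by linarith
      ultimately have ends: "0 \<in> w ` E" "t - s \<in> w ` E" using E by force+
      have "connected (w ` E)" using cont E(3) by (rule connected_continuous_image)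
      then have "is_interval (w ` E)" by (simp add: is_interval_connected_1)
      then have sub: "x - s \<in> w ` E" if "x \<in> closed_segment s t" for x
        using ends that mem_is_interval_1_I[of "w ` E" 0 "t - s" "x - s"]
          mem_is_interval_1_I[of "w ` E" "t - s" 0 "x - s"]
        by (auto simp: closed_segment_eq_real_ivl split: if_splits)
      have "g x \<in> E" if x: "x \<in> closed_segment s t" for x
      proof -
        obtain z where "z \<in> E" "x - s = w z" using sub[OF x] by blast
        then show ?thesis using gw[of z] by (metis add.commute diff_add_cancel)
      qed
      then have "dist (g a) (g b) \<le> B * dist (g s) (g t)" using dist_E ab by blast
      also have "\<dots> \<le> K * dist (g s) (g t)"
        using D by (intro mult_right_mono) (auto simp: K_def)
      finally show ?thesis .
    next
      case False
      have "dist (g a) (g b) \<le> diameter X / \<delta> * \<delta>" using \<delta>(1) by (simp add: dist_le_diameter)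
      also have "\<dots> \<le> diameter X / \<delta> * (B * dist (g s) (g t))"
        using False diameter_nonneg \<delta>(1) by (intro mult_left_mono) auto
      also have "\<dots> = diameter X * B / \<delta> * dist (g s) (g t)" by simp
      also have "\<dots> \<le> K * dist (g s) (g t)" using B by (intro mult_right_mono) (auto simp: K_def)
      finally show ?thesis .
    qed
  qed
qed

text \<open>A relation, because lifts are not unique; the closeness conditions determine them up to
  a common period.\<close>

definition is_median :: "'a \<times> 'a \<times> 'a \<Rightarrow> 'a \<Rightarrow> bool" where
  "is_median p m \<longleftrightarrow> (\<exists>t1 t2 t3. p = (g t1, g t2, g t3) \<and>
     \<bar>t1 - t2\<bar> \<le> 1 \<and> \<bar>t1 - t3\<bar> \<le> 1 \<and> m = g (median t1 t2 t3))"

text \<open>Shift the second triple of lifts against the first so that the first coordinates agree.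
  The other coordinates then differ by at most 2, so they agree as well, and the median commutes
  with translations.\<close>

lemma is_median_unique:
  assumes "is_median p m" "is_median p m'"
  shows "m = m'"
proof -
  obtain t1 t2 t3 where t: "p = (g t1, g t2, g t3)" "\<bar>t1 - t2\<bar> \<le> 1" "\<bar>t1 - t3\<bar> \<le> 1"
    "m = g (median t1 t2 t3)"
    using assms(1) unfolding is_median_def by blast
  obtain s1 s2 s3 where s: "p = (g s1, g s2, g s3)" "\<bar>s1 - s2\<bar> \<le> 1" "\<bar>s1 - s3\<bar> \<le> 1"
    "m' = g (median s1 s2 s3)"
    using assms(2) unfolding is_median_def by blast
  have "g s1 = g t1" using t s by simp
  then obtain n :: int where n: "s1 = t1 + 2 * pi * n" unfolding g_eq_iff by blast
  have shift: "g (x + 2 * pi * n) = g x" for x unfolding g_eq_iff by blast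
  have "s2 = t2 + 2 * pi * n"
    using t s n shift[of t2] by (intro g_eq_imp_eq) auto
  moreover have "s3 = t3 + 2 * pi * n"
    using t s n shift[of t3] by (intro g_eq_imp_eq) auto
  ultimately show ?thesis using n t s by (simp add: median_add shift)
qed

lemma bounded_turning_imp_mixer:
  assumes "bounded_turning X"
  shows "admits_local_lipschitz_mixer X"
proof -
  obtain K where K: "K \<ge> 0"
    "\<And>s t a b. \<bar>s - t\<bar> \<le> 1 \<Longrightarrow> a \<in> closed_segment s t \<Longrightarrow> b \<in> closed_segment s t \<Longrightarrow>
      dist (g a) (g b) \<le> K * dist (g s) (g t)"
    using segment_estimate[OF assms] by blast
  have move: "dist (g (median s p q)) (g (median t p q)) \<le> K * dist (g s) (g t)"
    if "\<bar>s - t\<bar> \<le> 1" for s t p q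
    using median_moves_in_segment[of s p q t] K(2)[OF that] K(1) by auto
  \<comment> \<open>The coordinates are changed one at a time; the symmetry of the median reduces
    each change to \<open>move\<close>.\<close>
  have move3: "dist (g (median s1 s2 s3)) (g (median t1 t2 t3)) \<le>
      K * dist3 (g s1, g s2, g s3) (g t1, g t2, g t3)"
    if "\<bar>s1 - t1\<bar> \<le> 1" "\<bar>s2 - t2\<bar> \<le> 1" "\<bar>s3 - t3\<bar> \<le> 1" for s1 s2 s3 t1 t2 t3
  proof -
    have "dist (g (median s1 s2 s3)) (g (median t1 t2 t3)) \<le>
      dist (g (median s1 s2 s3)) (g (median t1 s2 s3)) +
      dist (g (median t1 s2 s3)) (g (median t1 t2 s3)) +
      dist (g (median t1 t2 s3)) (g (median t1 t2 t3))"
      by (metis add_right_mono dist_triangle order_trans)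
    also have "\<dots> \<le> K * dist (g s1) (g t1) + K * dist (g s2) (g t2) + K * dist (g s3) (g t3)"
      using move[of s1 t1 s2 s3] move[of s2 t2 t1 s3] move[of s3 t3 t1 t2] that
      by (intro add_mono) (metis median_commute)+
    finally show ?thesis by (simp add: dist3_def algebra_simps)
  qed
  \<comment> \<open>With 1/4, lifts of \<open>q\<close> chosen near those of \<open>p\<close>
    satisfy the closeness conditions of \<open>is_median\<close>: the three errors add up to less
    than 3/4.\<close>
  obtain \<delta> where \<delta>: "\<delta> > 0"
    "\<And>t y. y \<in> X \<Longrightarrow> dist (g t) y < \<delta> \<Longrightarrow> \<exists>s. y = g s \<and> \<bar>s - t\<bar> < 1 / 4"
    using lift_near[of "1 / 4"] by auto
  \<comment> \<open>Halving turns the weak inequality in \<open>Delta3\<close> into the strict one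
    required for lifting.\<close>
  define r where "r = \<delta> / 2"
  have r: "0 < r" "r < \<delta>" using \<delta>(1) by (auto simp: r_def)
  have lifts: "\<exists>t1 t2 t3. p = (g t1, g t2, g t3) \<and> \<bar>t2 - t1\<bar> < 1 / 4 \<and> \<bar>t3 - t1\<bar> < 1 / 4"
    if "p \<in> Delta3 r X" for p
  proof -
    obtain x y z where p: "p = (x, y, z)" by (cases p)
    then have xyz: "x \<in> X" "y \<in> X" "z \<in> X" "dist x y < \<delta>" "dist x z < \<delta>"
      using that r by (auto simp: Delta3_iff)
    then obtain t1 where "x = g t1" using range_g by blast
    then show ?thesis using \<delta>(2)[of y t1] \<delta>(2)[of z t1] xyz p by blast
  qed
  define \<sigma> where "\<sigma> p = (SOME m. is_median p m)" for p
  have \<sigma>_eq: "\<sigma> p = m" if "is_median p m" for p m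
    unfolding \<sigma>_def using that is_median_unique by (blast intro: some_equality)
  have \<sigma>_lift: "\<sigma> (g t1, g t2, g t3) = g (median t1 t2 t3)"
    if "\<bar>t1 - t2\<bar> \<le> 1" "\<bar>t1 - t3\<bar> \<le> 1" for t1 t2 t3
    using that by (intro \<sigma>_eq) (auto simp: is_median_def)
  \<comment> \<open>\<open>K\<close> serves triples at distance less than \<delta>, and the second
    term those at distance at least \<delta>, which exceeds \<open>r\<close>.\<close>
  define L where "L = K + diameter X / r"
  have D: "diameter X / r \<ge> 0" using diameter_nonneg r by simp
  have dist3_nonneg: "dist3 p q \<ge> 0" for p q :: "'a \<times> 'a \<times> 'a"
    by (auto simp: dist3_def split: prod.split)
  have \<sigma>_X: "\<sigma> \<in> Delta3 r X \<rightarrow> X"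
  proof
    fix p assume "p \<in> Delta3 r X"
    then obtain t1 t2 t3 where "p = (g t1, g t2, g t3)" "\<bar>t2 - t1\<bar> < 1 / 4" "\<bar>t3 - t1\<bar> < 1 / 4"
      using lifts by blast
    moreover from this have "\<sigma> (g t1, g t2, g t3) = g (median t1 t2 t3)"
      by (intro \<sigma>_lift) linarith+
    ultimately show "\<sigma> p \<in> X" by simp
  qed
  have "dist (\<sigma> p) (\<sigma> q) \<le> L * dist3 p q" if pq: "p \<in> Delta3 r X" "q \<in> Delta3 r X" for p q
  proof (cases "dist3 p q < \<delta>")
    case True
    obtain t1 t2 t3 where t: "p = (g t1, g t2, g t3)" "\<bar>t2 - t1\<bar> < 1 / 4" "\<bar>t3 - t1\<bar> < 1 / 4"
      using lifts[OF pq(1)] by blast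
    obtain y1 y2 y3 where q: "q = (y1, y2, y3)" by (cases q)
    have y: "y1 \<in> X" "y2 \<in> X" "y3 \<in> X" using pq(2) q by (auto simp: Delta3_iff)
    have "dist (g t1) y1 + dist (g t2) y2 + dist (g t3) y3 < \<delta>"
      using True t(1) q by (simp add: dist3_def)
    then have near: "dist (g t1) y1 < \<delta>" "dist (g t2) y2 < \<delta>" "dist (g t3) y3 < \<delta>"
      by (smt (verit) zero_le_dist)+
    \<comment> \<open>Each coordinate of \<open>q\<close> is lifted next to the corresponding lift
      for \<open>p\<close>, not next to the first lift of \<open>q\<close>, so that
      \<open>move3\<close> applies.\<close>
    obtain s1 where s1: "y1 = g s1" "\<bar>s1 - t1\<bar> < 1 / 4" using \<delta>(2)[OF y(1) near(1)] by blast
    obtain s2 where s2: "y2 = g s2" "\<bar>s2 - t2\<bar> < 1 / 4" using \<delta>(2)[OF y(2) near(2)] by blast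
    obtain s3 where s3: "y3 = g s3" "\<bar>s3 - t3\<bar> < 1 / 4" using \<delta>(2)[OF y(3) near(3)] by blast
    have "\<sigma> p = g (median t1 t2 t3)"
      unfolding t(1) using t(2,3) by (intro \<sigma>_lift) linarith+
    moreover have "\<sigma> q = g (median s1 s2 s3)"
      unfolding q s1(1) s2(1) s3(1) using t(2,3) s1(2) s2(2) s3(2) by (intro \<sigma>_lift) linarith+
    moreover have "dist (g (median t1 t2 t3)) (g (median s1 s2 s3)) \<le> K * dist3 p q"
      unfolding q t(1) s1(1) s2(1) s3(1) using s1(2) s2(2) s3(2) by (intro move3) linarith+
    moreover have "K * dist3 p q \<le> L * dist3 p q"
      using D dist3_nonneg by (intro mult_right_mono) (auto simp: L_def)
    ultimately show ?thesis by simp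
  next
    case False
    have "dist (\<sigma> p) (\<sigma> q) \<le> diameter X / r * r"
      using r \<sigma>_X pq by (auto intro!: dist_le_diameter)
    also have "\<dots> \<le> diameter X / r * dist3 p q"
      using D False r by (intro mult_left_mono) auto
    also have "\<dots> \<le> L * dist3 p q"
      using K(1) dist3_nonneg by (intro mult_right_mono) (auto simp: L_def)
    finally show ?thesis .
  qed
  moreover have "L \<ge> 0" using K(1) D by (simp add: L_def)
  ultimately have "lipschitz3 (Delta3 r X) \<sigma>" unfolding lipschitz3_def by blast
  moreover have "\<sigma> (a, a, b) = a \<and> \<sigma> (a, b, a) = a \<and> \<sigma> (b, a, a) = a"
    if ab: "a \<in> X" "b \<in> X" "(a, a, b) \<in> Delta3 r X" for a b
  proof -
    obtain t where t: "a = g t" using ab range_g by blast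
    obtain s where s: "b = g s" "\<bar>s - t\<bar> < 1 / 4"
      using \<delta>(2)[of b t] ab t r by (auto simp: Delta3_iff)
    have "\<bar>s - t\<bar> \<le> 1" "\<bar>t - s\<bar> \<le> 1" using s(2) by linarith+
    then show ?thesis
      unfolding t s(1) using \<sigma>_lift[of t t s] \<sigma>_lift[of t s t] \<sigma>_lift[of s t t] by auto
  qed
  ultimately show ?thesis
    unfolding admits_local_lipschitz_mixer_def using r(1) \<sigma>_X by blast
qed

end

theorem theorem1p2:
  fixes X :: "'a::metric_space set"
  assumes "metric_circle X"
  shows "admits_local_lipschitz_mixer X \<longleftrightarrow> bounded_turning X"
proof -
  obtain g where "circle_covering X g"
    using metric_circle_covering[OF assms] by blast
  then interpret circle_covering X g .
  show ?thesis using mixer_imp_bounded_turning bounded_turning_imp_mixer by blast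
qed

end
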